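(* Let $N\ge1$ be an integer and $c=(c^1,\dots,c^N)$ a vector of strictly positive reals. For every non-empty $V\subseteq[N]$ and every $\tau\in[0,1]$, the recursive procedure $\mathtt{choose.a}(V,\tau)$, whichever admissible partitions are chosen in its steps, returns a matrix $a\in\mathbb{A}_V$ such that $N^{\rm eff}(a,c)\ge\tau|V|$.
   Context: $[N]:=\{1,\dots,N\}$. For non-empty $V\subseteq[N]$, $\mathbb{A}_V$ is the set of substochastic $N\times N$ matrices $a=(a^{ij})$ (nonnegative entries, each row sum at most $1$) such that (i) $a$ leaves the uniform distribution $\mu$ on $V$ invariant, i.e. $\mu a=\mu$ with $\mu$ viewed as a row vector on $[N]$, and (ii) $a^{ij}=0$ whenever $(i,j)\in[N]^2\setminus V^2$. For $a\in\mathbb{A}_V$ with $V$ non-empty, $$N^{\rm eff}(a,c):=\frac{\left(\sum_{i=1}^N\sum_{j=1}^N a^{ij}c^j\right)^2}{\sum_{i=1}^N\left(\sum_{j=1}^N a^{ij}c^j\right)^2}.$$ $\phi(\kappa(V))$ is the $N\times N$ matrix with $(i,j)$ entry $|V|^{-1}$ if $i,j\in V$ and $0$ otherwise. For a partition $P$ of $V$ (into non-empty parts), $$N^{\rm eff}(P,c):=\frac{\left(\sum_{S\in P}\sum_{j\in S}c^j\right)^2}{\sum_{S\in P}|S|\left(|S|^{-1}\sum_{j\in S}c^j\right)^2},\qquad \rho(P,c):=|V|^{-1}N^{\rm eff}(P,c).$$ The recursive procedure $\mathtt{choose.a}(V,\tau)$ is: 1. Choose any partition $P=\{V_k:k\in[K]\}$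 of $V$ such that $\rho(P,c)\ge\tau$. 2. If $P=\{V\}$ then return $\phi(\kappa(V))$. 3. Otherwise, return $\sum_{k\in[K]}\mathtt{choose.a}(V_k,\tau/\rho(P,c))$. *)

theory Defs
  imports "HOL-Analysis.Analysis" "HOL-Library.Disjoint_Sets"
begin

text \<open>The index set \<open>[N]\<close> is a finite type \<open>'n\<close>, so \<open>N = CARD('n)\<close> is an arbitrary integer
  \<open>\<ge> 1\<close>; \<open>a $ i $ j\<close> is the entry in row \<open>i\<close> and column \<open>j\<close>.\<close>

definition substochastic :: "real^'n^'n \<Rightarrow> bool" where
  "substochastic a \<longleftrightarrow> (\<forall>i j. 0 \<le> a $ i $ j) \<and> (\<forall>i. (\<Sum>j\<in>UNIV. a $ i $ j) \<le> 1)"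

definition unif :: "'n set \<Rightarrow> real^'n" where
  "unif V = (\<chi> i. if i \<in> V then 1 / real (card V) else 0)"

definition AA :: "'n set \<Rightarrow> (real^'n^'n) set" where
  "AA V = {a. substochastic a \<and> unif V v* a = unif V \<and>
              (\<forall>i j. (i, j) \<notin> V \<times> V \<longrightarrow> a $ i $ j = 0)}"

definition Neff :: "real^'n^'n \<Rightarrow> real^'n \<Rightarrow> real" where
  "Neff a c = (\<Sum>i\<in>UNIV. \<Sum>j\<in>UNIV. a $ i $ j * c $ j)\<^sup>2 /
              (\<Sum>i\<in>UNIV. (\<Sum>j\<in>UNIV. a $ i $ j * c $ j)\<^sup>2)"

text \<open>The matrix \<open>\<phi>(\<kappa>(V))\<close>.\<close>

definition phi_kappa :: "'n set \<Rightarrow> real^'n^'n" where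
  "phi_kappa V = (\<chi> i j. if i \<in> V \<and> j \<in> V then 1 / real (card V) else 0)"

definition Neff_part :: "'n set set \<Rightarrow> real^'n \<Rightarrow> real" where
  "Neff_part P c = (\<Sum>S\<in>P. \<Sum>j\<in>S. c $ j)\<^sup>2 /
                   (\<Sum>S\<in>P. real (card S) * ((\<Sum>j\<in>S. c $ j) / real (card S))\<^sup>2)"

definition rho :: "'n set \<Rightarrow> 'n set set \<Rightarrow> real^'n \<Rightarrow> real" where
  "rho V P c = Neff_part P c / real (card V)"

text \<open>The partitions that may be chosen in the first step of \<open>choose.a(V, \<tau>)\<close>.\<close>

definition admissible :: "real^'n \<Rightarrow> 'n set \<Rightarrow> real \<Rightarrow> 'n set set \<Rightarrow> bool" where
  "admissible c V \<tau> P \<longleftrightarrow> partition_on V P \<and> \<tau> \<le> rho V P c"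

text \<open>The procedure is nondeterministic. \<open>choose_a c V \<tau> a\<close> says that some run of
  \<open>choose.a(V, \<tau>)\<close> returns \<open>a\<close>; the recursive calls choose their partitions independently of
  one another.\<close>

inductive choose_a :: "real^'n \<Rightarrow> 'n set \<Rightarrow> real \<Rightarrow> real^'n^'n \<Rightarrow> bool" for c :: "real^'n" where
  stop: "admissible c V \<tau> P \<Longrightarrow> P = {V} \<Longrightarrow> choose_a c V \<tau> (phi_kappa V)"
| split: "admissible c V \<tau> P \<Longrightarrow> P \<noteq> {V} \<Longrightarrow>
    (\<forall>S\<in>P. choose_a c S (\<tau> / rho V P c) (A S)) \<Longrightarrow> choose_a c V \<tau> (\<Sum>S\<in>P. A S)"

text \<open>\<open>choose_a\<close> is silent about runs that recurse forever or find no admissible partition.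
  \<open>always_returns c V \<tau>\<close> says that there are none: an admissible partition exists, and whichever
  is chosen, all resulting recursive calls always return. Being a least fixed point, it excludes
  infinite recursion.\<close>

inductive always_returns :: "real^'n \<Rightarrow> 'n set \<Rightarrow> real \<Rightarrow> bool" for c :: "real^'n" where
  "(\<exists>P. admissible c V \<tau> P) \<Longrightarrow>
    (\<forall>P. admissible c V \<tau> P \<longrightarrow> P \<noteq> {V} \<longrightarrow> (\<forall>S\<in>P. always_returns c S (\<tau> / rho V P c))) \<Longrightarrow>
    always_returns c V \<tau>"

lemma always_returns_imp_output:
  "always_returns c V \<tau> \<Longrightarrow> \<exists>a. choose_a c V \<tau> a"
proof (induction rule: always_returns.induct)
  case (1 V \<tau>)
  then obtain P where P: "admissible c V \<tau> P" by blast
  show ?case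
  proof (cases "P = {V}")
    case True
    then show ?thesis using P choose_a.stop by blast
  next
    case False
    then have "\<forall>S\<in>P. \<exists>a. choose_a c S (\<tau> / rho V P c) a" using 1 P by blast
    then obtain A where "\<forall>S\<in>P. choose_a c S (\<tau> / rho V P c) (A S)" by metis
    then show ?thesis using P False choose_a.split by blast
  qed
qed

end

theory Submission
  imports Defs
begin

text \<open>Write \<open>s(V) = \<Sum>j\<in>V. c $ j\<close>. Every \<open>a \<in> AA V\<close> has column sums equal to the indicator of \<open>V\<close>,
  so the entries of \<open>a *v c\<close> sum to \<open>s(V)\<close>, and the bound on \<open>Neff\<close> says
  \<open>\<tau> |V| Q(a) \<le> s(V)\<^sup>2\<close> for the sum of squares \<open>Q(a) = (a *v c) \<bullet> (a *v c)\<close>. As the matrices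
  returned by the recursive calls have disjoint supports, \<open>Q\<close> is additive over them, and the bounds
  for the parts, divided by \<open>|S|\<close>, add up to \<open>(\<tau> / \<rho>) Q(a) \<le> (\<Sum>S\<in>P. s(S)\<^sup>2 / |S|) = s(V)\<^sup>2 / (\<rho> |V|)\<close>.
  Runs terminate because the parts of a partition other than \<open>{V}\<close> are smaller than \<open>V\<close>. They never
  get stuck because \<open>\<rho>({V}) = 1\<close> and the thresholds \<open>\<tau> / \<rho>\<close> passed to the calls stay at most \<open>1\<close>.\<close>

section \<open>Matrices in \<open>AA V\<close> and their effective number\<close>

text \<open>Rows outside \<open>V\<close> vanish and \<open>unif V\<close> is constant on
  \<open>V\<close>, so entry \<open>j\<close> of \<open>unif V v* a\<close> is the column sum
  divided by \<open>card V\<close>. Column sums are additive over blocks, whereas the weight in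
  \<open>unif\<close> changes from block to block.\<close>

lemma AA_iff:
  fixes V :: "'n::finite set"
  assumes "V \<noteq> {}"
  shows "a \<in> AA V \<longleftrightarrow> substochastic a \<and> (\<forall>j. (\<Sum>i\<in>UNIV. a $ i $ j) = of_bool (j \<in> V)) \<and>
    (\<forall>i j. (i, j) \<notin> V \<times> V \<longrightarrow> a $ i $ j = 0)"
proof -
  have card: "real (card V) > 0"
    using assms by (simp add: card_gt_0_iff)
  have "(unif V v* a) $ j = (\<Sum>i\<in>UNIV. a $ i $ j) / real (card V)"
    if "\<forall>i j. (i, j) \<notin> V \<times> V \<longrightarrow> a $ i $ j = 0" for j
    unfolding vector_matrix_mult_def unif_def sum_divide_distrib
    using that by (auto intro!: sum.cong)
  then have "unif V v* a = unif V \<longleftrightarrow> (\<forall>j. (\<Sum>i\<in>UNIV. a $ i $ j) = of_bool (j \<in> V))"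
    if "\<forall>i j. (i, j) \<notin> V \<times> V \<longrightarrow> a $ i $ j = 0"
    using that card assms by (simp add: vec_eq_iff) (auto simp: unif_def)
  then show ?thesis
    unfolding AA_def by blast
qed

lemma phi_kappa_in_AA:
  fixes V :: "'n::finite set"
  assumes "V \<noteq> {}"
  shows "phi_kappa V \<in> AA V"
proof -
  have card: "real (card V) > 0"
    using assms by (simp add: card_gt_0_iff)
  have "(\<Sum>j\<in>UNIV. phi_kappa V $ i $ j) = of_bool (i \<in> V)"
    and "(\<Sum>i\<in>UNIV. phi_kappa V $ i $ j) = of_bool (j \<in> V)" for i j
    using card by (auto simp: phi_kappa_def simp flip: sum.inter_filter)
  then show ?thesis
    unfolding AA_iff[OF assms] substochastic_def by (auto simp: phi_kappa_def)
qed

lemma sum_mult_vec_AA: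
  fixes V :: "'n::finite set"
  assumes "V \<noteq> {}" "a \<in> AA V"
  shows "(\<Sum>i\<in>UNIV. (a *v c) $ i) = (\<Sum>j\<in>V. c $ j)"
proof -
  have "(\<Sum>i\<in>UNIV. (a *v c) $ i) = (\<Sum>j\<in>UNIV. (\<Sum>i\<in>UNIV. a $ i $ j) * c $ j)"
    unfolding matrix_vector_mult_def by (simp add: sum_distrib_right) (rule sum.swap)
  also have "\<dots> = (\<Sum>j\<in>UNIV. if j \<in> V then c $ j else 0)"
    using assms(2) unfolding AA_iff[OF assms(1)] by (intro sum.cong) simp_all
  also have "\<dots> = (\<Sum>j\<in>V. c $ j)"
    by (simp flip: sum.inter_filter)
  finally show ?thesis .
qed

lemma Neff_altdef:
  "Neff a c = (\<Sum>i\<in>UNIV. (a *v c) $ i)\<^sup>2 / (\<Sum>i\<in>UNIV. ((a *v c) $ i)\<^sup>2)"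
  unfolding Neff_def matrix_vector_mult_def by simp

text \<open>The denominator is positive because the entries of \<open>a *v c\<close> sum to a
  positive number and so cannot all vanish. Cleared of the quotient, the bound can be summed over
  blocks.\<close>

lemma le_Neff_iff:
  fixes V :: "'n::finite set"
  assumes "\<And>j. 0 < c $ j" "V \<noteq> {}" "a \<in> AA V"
  shows "t \<le> Neff a c \<longleftrightarrow> t * (\<Sum>i\<in>UNIV. ((a *v c) $ i)\<^sup>2) \<le> (\<Sum>j\<in>V. c $ j)\<^sup>2"
proof -
  have sum: "(\<Sum>i\<in>UNIV. (a *v c) $ i) = (\<Sum>j\<in>V. c $ j)"
    using assms by (simp add: sum_mult_vec_AA)
  moreover have "(\<Sum>j\<in>V. c $ j) > 0"
    using assms by (intro sum_pos) auto
  ultimately have "\<exists>i. (a *v c) $ i \<noteq> 0"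
    by (metis sum.neutral less_irrefl)
  then have "(\<Sum>i\<in>UNIV. ((a *v c) $ i)\<^sup>2) > 0"
    by (metis UNIV_I finite sum_pos2 zero_le_power2 zero_less_power2)
  then show ?thesis
    unfolding Neff_altdef sum by (simp add: pos_le_divide_eq)
qed

text \<open>Averaging makes all entries of \<open>phi_kappa V *v c\<close> on \<open>V\<close>
  equal, and a vector with \<open>card V\<close> equal nonzero entries and zeros elsewhere has
  effective number \<open>card V\<close>.\<close>

lemma Neff_phi_kappa:
  fixes V :: "'n::finite set"
  assumes "\<And>j. 0 < c $ j" "V \<noteq> {}"
  shows "Neff (phi_kappa V) c = real (card V)"
proof -
  have "(\<Sum>j\<in>V. c $ j) > 0" and "card V > 0"
    using assms by (auto intro!: sum_pos simp: card_gt_0_iff)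
  moreover have "(phi_kappa V *v c) $ i = (if i \<in> V then (\<Sum>j\<in>V. c $ j) / real (card V) else 0)" for i
    by (simp add: matrix_vector_mult_def phi_kappa_def if_distrib[of "\<lambda>x. x * _"] sum_divide_distrib
        cong: if_cong flip: sum.inter_filter)
  ultimately show ?thesis
    using assms(2) unfolding Neff_altdef
    by (simp add: if_distrib[of "\<lambda>x. x\<^sup>2"] power_divide cong: if_cong flip: sum.inter_filter)
      (simp add: power2_eq_square)
qed

section \<open>Partitions and the ratio \<open>rho\<close>\<close>

lemma rho_eq:
  fixes V :: "'n::finite set"
  assumes "partition_on V P"
  shows "rho V P c =
    (\<Sum>j\<in>V. c $ j)\<^sup>2 / ((\<Sum>S\<in>P. (\<Sum>j\<in>S. c $ j)\<^sup>2 / real (card S)) * real (card V))"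
proof -
  have "(\<Sum>S\<in>P. \<Sum>j\<in>S. c $ j) = (\<Sum>j\<in>V. c $ j)"
    using assms sum.Union_disjoint[of P "\<lambda>j. c $ j"] by (simp add: partition_on_def disjoint_def)
  \<comment> \<open>For \<open>card S = 0\<close> both sides are 0, as division by zero yields
    0.\<close>
  moreover have "real (card S) * ((\<Sum>j\<in>S. c $ j) / real (card S))\<^sup>2 = (\<Sum>j\<in>S. c $ j)\<^sup>2 / real (card S)" for S
    by (simp add: power_divide power2_eq_square)
  ultimately show ?thesis
    by (simp add: rho_def Neff_part_def)
qed

lemma rho_pos:
  fixes V :: "'n::finite set"
  assumes "\<And>j. 0 < c $ j" "V \<noteq> {}" "partition_on V P"
  shows "0 < rho V P c"
proof -
  have pos: "(\<Sum>j\<in>S. c $ j) > 0" "real (card S) > 0" if "S \<noteq> {}" for S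
    using assms(1) that by (auto intro!: sum_pos simp: card_gt_0_iff)
  have nonempty: "S \<noteq> {}" if "S \<in> P" for S
    using assms that by (auto simp: partition_on_def)
  have "(\<Sum>S\<in>P. (\<Sum>j\<in>S. c $ j)\<^sup>2 / real (card S)) > 0"
  proof (rule sum_pos)
    show "P \<noteq> {}"
      using assms by (auto simp: partition_on_def)
    show "(\<Sum>j\<in>S. c $ j)\<^sup>2 / real (card S) > 0" if "S \<in> P" for S
      using pos[OF nonempty[OF that]] by simp
  qed simp
  then show ?thesis
    unfolding rho_eq[OF assms(3)] using pos[OF assms(2)] by simp
qed

text \<open>This value serves twice: stopping is admissible whenever \<tau> \<le> 1, and conversely
  a run that stops must have \<tau> \<le> 1.\<close>

lemma rho_trivial:
  fixes V :: "'n::finite set"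
  assumes "\<And>j. 0 < c $ j" "V \<noteq> {}"
  shows "rho V {V} c = 1"
proof -
  have "(\<Sum>j\<in>V. c $ j) > 0" "card V > 0"
    using assms by (auto intro!: sum_pos simp: card_gt_0_iff)
  then show ?thesis
    using rho_eq[OF partition_on_space[OF assms(2)], of c] assms(2) by simp
qed

text \<open>If \<open>V\<close> itself were a part, any part \<open>T\<close> would meet it in
  \<open>T\<close>, which is non-empty, so disjointness would force \<open>T = V\<close>.\<close>

lemma psubset_of_part:
  assumes "partition_on V P" "P \<noteq> {V}" "S \<in> P"
  shows "S \<subset> V"
proof -
  have "P = {V}" if "S = V"
  proof -
    have "T \<inter> V = T" "T \<noteq> {}" if "T \<in> P" for T
      using assms(1) that by (auto simp: partition_on_def)
    then show ?thesis
      using assms(1,3) that by (auto simp: partition_on_def dest: disjointD)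
  qed
  then show ?thesis
    using assms by (auto simp: partition_on_def)
qed

section \<open>Block sums over a partition\<close>

text \<open>An index of \<open>S\<close> lies in no other part, so the corresponding row of every
  other summand is zero.\<close>

lemma sum_AA_row:
  fixes P :: "'n::finite set set"
  assumes "partition_on V P" "\<And>S. S \<in> P \<Longrightarrow> A S \<in> AA S" "S \<in> P" "i \<in> S"
  shows "(\<Sum>S\<in>P. A S) $ i = A S $ i"
proof -
  have "A T $ i = 0" if "T \<in> P - {S}" for T
  proof -
    have "i \<notin> T"
      using assms that by (auto simp: partition_on_def disjoint_def)
    then show ?thesis
      using assms that by (auto simp: AA_def vec_eq_iff)
  qed
  then have "(\<Sum>T\<in>P. A T $ i) = A S $ i"
    using assms by (subst sum.remove[of _ S]) auto
  then show ?thesis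
    by simp
qed

lemma sum_in_AA:
  fixes V :: "'n::finite set"
  assumes "V \<noteq> {}" "partition_on V P" "\<And>S. S \<in> P \<Longrightarrow> A S \<in> AA S"
  shows "(\<Sum>S\<in>P. A S) \<in> AA V"
proof -
  have A: "substochastic (A S)" "(\<Sum>i\<in>UNIV. A S $ i $ j) = of_bool (j \<in> S)"
    "(i, j) \<notin> S \<times> S \<Longrightarrow> A S $ i $ j = 0" if "S \<in> P" for S i j
  proof -
    have "S \<noteq> {}"
      using assms(2) that by (auto simp: partition_on_def)
    then show "substochastic (A S)" "(\<Sum>i\<in>UNIV. A S $ i $ j) = of_bool (j \<in> S)"
      "(i, j) \<notin> S \<times> S \<Longrightarrow> A S $ i $ j = 0"
      using assms(3)[OF that] AA_iff[of S "A S"] by blast+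
  qed
  have supp: "(\<Sum>S\<in>P. A S) $ i $ j = 0" if "(i, j) \<notin> V \<times> V" for i j
    using that A(3) assms(2) by (auto simp: partition_on_def intro!: sum.neutral)
  have row: "\<exists>S\<in>P. (\<Sum>S\<in>P. A S) $ i = A S $ i" if i: "i \<in> V" for i
  proof -
    obtain S where "S \<in> P" "i \<in> S"
      using i assms(2) by (auto simp: partition_on_def)
    then show ?thesis
      using sum_AA_row[OF assms(2,3)] by blast
  qed
  have "substochastic (\<Sum>S\<in>P. A S)"
    unfolding substochastic_def
  proof (intro conjI allI)
    show "0 \<le> (\<Sum>S\<in>P. A S) $ i $ j" for i j
      using A(1) by (auto simp: substochastic_def intro!: sum_nonneg)
    \<comment> \<open>Adding the row bounds of the summands would only give \<open>card P\<close>;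
      the bound 1 holds because each row of the sum is a row of a single block or zero.\<close>
    show "(\<Sum>j\<in>UNIV. (\<Sum>S\<in>P. A S) $ i $ j) \<le> 1" for i
    proof (cases "i \<in> V")
      case True
      then obtain S where "S \<in> P" "(\<Sum>S\<in>P. A S) $ i = A S $ i"
        using row by blast
      then show ?thesis
        using A(1) by (simp add: substochastic_def del: sum_component)
    next
      case False
      then show ?thesis
        using supp by (simp del: sum_component)
    qed
  qed
  moreover have "(\<Sum>i\<in>UNIV. (\<Sum>S\<in>P. A S) $ i $ j) = of_bool (j \<in> V)" for j
  proof -
    have "(\<Sum>i\<in>UNIV. (\<Sum>S\<in>P. A S) $ i $ j) = (\<Sum>S\<in>P. \<Sum>i\<in>UNIV. A S $ i $ j)"
      by simp (rule sum.swap)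
    also have "\<dots> = (\<Sum>S\<in>P. of_bool (j \<in> S))"
      using A(2) by simp
    also have "\<dots> = of_bool (j \<in> V)"
    proof (cases "j \<in> V")
      case True
      then obtain S where "S \<in> P" "j \<in> S"
        using assms(2) by (auto simp: partition_on_def)
      \<comment> \<open>By disjointness \<open>S\<close> is the only part containing
        \<open>j\<close>, so the indicators add up to 1.\<close>
      moreover have "j \<notin> T" if "T \<in> P - {S}" for T
        using assms(2) that calculation by (auto simp: partition_on_def disjoint_def)
      ultimately show ?thesis
        using True by (subst sum.remove[of _ S]) auto
    next
      case False
      then show ?thesis
        using assms(2) by (auto simp: partition_on_def)
    qed
    finally show ?thesis .
  qed
  ultimately show ?thesis
    unfolding AA_iff[OF assms(1)] using supp by blast
qed

lemma sum_squares_AA_support: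
  fixes S :: "'n::finite set"
  assumes "a \<in> AA S"
  shows "(\<Sum>i\<in>UNIV. ((a *v c) $ i)\<^sup>2) = (\<Sum>i\<in>S. ((a *v c) $ i)\<^sup>2)"
proof (rule sum.mono_neutral_right)
  show "\<forall>i\<in>UNIV - S. ((a *v c) $ i)\<^sup>2 = 0"
    using assms by (auto simp: AA_def matrix_vector_mult_def)
qed auto

text \<open>On the indices of a part only one summand contributes to the product with
  \<open>c\<close>, so squaring produces no cross terms.\<close>

lemma sum_squares_sum_AA:
  fixes V :: "'n::finite set"
  assumes "V \<noteq> {}" "partition_on V P" "\<And>S. S \<in> P \<Longrightarrow> A S \<in> AA S"
  shows "(\<Sum>i\<in>UNIV. (((\<Sum>S\<in>P. A S) *v c) $ i)\<^sup>2) = (\<Sum>S\<in>P. \<Sum>i\<in>UNIV. ((A S *v c) $ i)\<^sup>2)"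
proof -
  have row: "((\<Sum>S\<in>P. A S) *v c) $ i = (A S *v c) $ i" if "S \<in> P" "i \<in> S" for S i
    using sum_AA_row[OF assms(2,3) that] by (simp add: matrix_vector_mult_def del: sum_component)
  have "(\<Sum>i\<in>UNIV. (((\<Sum>S\<in>P. A S) *v c) $ i)\<^sup>2) = (\<Sum>i\<in>\<Union>P. (((\<Sum>S\<in>P. A S) *v c) $ i)\<^sup>2)"
    using sum_squares_AA_support[OF sum_in_AA[OF assms]] assms(2) by (simp add: partition_on_def)
  also have "\<dots> = (\<Sum>S\<in>P. \<Sum>i\<in>S. (((\<Sum>S\<in>P. A S) *v c) $ i)\<^sup>2)"
    using assms(2) by (subst sum.Union_disjoint) (auto simp: partition_on_def disjoint_def)
  also have "\<dots> = (\<Sum>S\<in>P. \<Sum>i\<in>UNIV. ((A S *v c) $ i)\<^sup>2)"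
  proof (rule sum.cong)
    show "(\<Sum>i\<in>S. (((\<Sum>S\<in>P. A S) *v c) $ i)\<^sup>2) = (\<Sum>i\<in>UNIV. ((A S *v c) $ i)\<^sup>2)" if "S \<in> P" for S
      using row[OF that] sum_squares_AA_support[OF assms(3)[OF that]] by simp
  qed simp
  finally show ?thesis .
qed

lemma le_Neff_sum:
  fixes V :: "'n::finite set"
  assumes c: "\<And>j. 0 < c $ j" and V: "V \<noteq> {}" and P: "partition_on V P"
    and A: "\<And>S. S \<in> P \<Longrightarrow> A S \<in> AA S"
    and le: "\<And>S. S \<in> P \<Longrightarrow> \<tau> / rho V P c * real (card S) \<le> Neff (A S) c"
  shows "\<tau> * real (card V) \<le> Neff (\<Sum>S\<in>P. A S) c"
proof -
  define Q where "Q a = (\<Sum>i\<in>UNIV. ((a *v c) $ i)\<^sup>2)" for a :: "real^'n^'n"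
  define D where "D = (\<Sum>S\<in>P. (\<Sum>j\<in>S. c $ j)\<^sup>2 / real (card S))"
  have card: "real (card V) > 0"
    using V by (simp add: card_gt_0_iff)
  have rho: "rho V P c > 0" "rho V P c = (\<Sum>j\<in>V. c $ j)\<^sup>2 / (D * real (card V))"
    using rho_pos[OF c V P] rho_eq[OF P] by (simp_all add: D_def)
  \<comment> \<open>Otherwise the quotient for \<open>rho\<close> would be 0, against its
    positivity.\<close>
  then have "D \<noteq> 0"
    by auto
  have Q_sum: "Q (\<Sum>S\<in>P. A S) = (\<Sum>S\<in>P. Q (A S))"
    unfolding Q_def using V P A by (rule sum_squares_sum_AA)
  have "\<tau> / rho V P c * Q (A S) \<le> (\<Sum>j\<in>S. c $ j)\<^sup>2 / real (card S)" if "S \<in> P" for S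
  proof -
    have S: "S \<noteq> {}"
      using that P by (auto simp: partition_on_def)
    then have "real (card S) > 0"
      by (simp add: card_gt_0_iff)
    moreover have "\<tau> / rho V P c * real (card S) * Q (A S) \<le> (\<Sum>j\<in>S. c $ j)\<^sup>2"
      using le_Neff_iff[OF c S A[OF that], THEN iffD1, OF le[OF that]] by (simp add: Q_def)
    ultimately show ?thesis
      by (simp add: pos_le_divide_eq mult_ac)
  qed
  then have "\<tau> / rho V P c * Q (\<Sum>S\<in>P. A S) \<le> D"
    unfolding Q_sum D_def sum_distrib_left by (rule sum_mono)
  then have "\<tau> * Q (\<Sum>S\<in>P. A S) \<le> D * rho V P c"
    using rho(1) by (simp add: pos_divide_le_eq)
  \<comment> \<open>Here the threshold \<open>\<tau> / rho V P c\<close> pays off: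
    \<open>rho\<close> is exactly the factor lost in passing from \<open>V\<close> to its
    parts.\<close>
  also have "D * rho V P c = (\<Sum>j\<in>V. c $ j)\<^sup>2 / real (card V)"
    unfolding rho(2) using \<open>D \<noteq> 0\<close> by simp
  finally have "\<tau> * real (card V) * Q (\<Sum>S\<in>P. A S) \<le> (\<Sum>j\<in>V. c $ j)\<^sup>2"
    using card by (simp add: pos_le_divide_eq mult_ac)
  then show ?thesis
    using le_Neff_iff[OF c V sum_in_AA[OF V P A]] by (simp add: Q_def)
qed

section \<open>Correctness and termination of the procedure\<close>

lemma choose_a_sound:
  fixes V :: "'n::finite set"
  assumes c: "\<And>j. 0 < c $ j"
  shows "choose_a c V \<tau> a \<Longrightarrow> V \<noteq> {} \<Longrightarrow> a \<in> AA V \<and> \<tau> * real (card V) \<le> Neff a c"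
proof (induction rule: choose_a.induct)
  case (stop V \<tau> P)
  \<comment> \<open>Admissibility of \<open>{V}\<close> bounds \<tau> by \<open>rho V {V} c\<close>,
    which is 1.\<close>
  then have "\<tau> \<le> 1"
    using rho_trivial[OF c] by (auto simp: admissible_def)
  then show ?case
    using phi_kappa_in_AA Neff_phi_kappa[OF c] \<open>V \<noteq> {}\<close> by (auto intro: mult_right_mono[of \<tau> 1, simplified])
next
  case (split V \<tau> P A)
  then have P: "partition_on V P"
    by (simp add: admissible_def)
  have IH: "A S \<in> AA S" "\<tau> / rho V P c * real (card S) \<le> Neff (A S) c" if "S \<in> P" for S
    using split that P by (auto simp: partition_on_def)
  show ?case
    using sum_in_AA[OF \<open>V \<noteq> {}\<close> P IH(1)] le_Neff_sum[OF c \<open>V \<noteq> {}\<close> P IH] by blast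
qed

text \<open>Induction on \<open>card V\<close> with \<tau> arbitrary, since recursive calls change
  both the set and the threshold.\<close>

lemma always_returns_le_one:
  fixes V :: "'n::finite set"
  assumes c: "\<And>j. 0 < c $ j"
  shows "V \<noteq> {} \<Longrightarrow> \<tau> \<le> 1 \<Longrightarrow> always_returns c V \<tau>"
proof (induction "card V" arbitrary: V \<tau> rule: less_induct)
  case less
  show ?case
  proof (rule always_returns.intros)
    have "admissible c V \<tau> {V}"
      using less.prems rho_trivial[OF c] partition_on_space[of V] by (simp add: admissible_def)
    then show "\<exists>P. admissible c V \<tau> P" ..
    show "\<forall>P. admissible c V \<tau> P \<longrightarrow> P \<noteq> {V} \<longrightarrow> (\<forall>S\<in>P. always_returns c S (\<tau> / rho V P c))"
    proof (intro allI impI ballI)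
      fix P S
      assume P: "admissible c V \<tau> P" "P \<noteq> {V}" "S \<in> P"
      then have "card S < card V"
        using psubset_of_part by (intro psubset_card_mono) (auto simp: admissible_def)
      moreover have "S \<noteq> {}"
        using P by (auto simp: admissible_def partition_on_def)
      \<comment> \<open>This is the admissibility condition \<tau> \<le> \<open>rho V P c\<close>
        divided by the positive \<open>rho V P c\<close>.\<close>
      moreover have "\<tau> / rho V P c \<le> 1"
        using P rho_pos[OF c less.prems(1)] by (auto simp: admissible_def)
      ultimately show "always_returns c S (\<tau> / rho V P c)"
        using less.hyps by blast
    qed
  qed
qed

theorem proposition5:
  fixes c :: "real^'n" and V :: "'n set" and \<tau> :: real
  assumes "\<And>j. 0 < c $ j"
    and "V \<noteq> {}"
    and "0 \<le> \<tau>" and "\<tau> \<le> 1"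
  shows "always_returns c V \<tau> \<and>
    (\<forall>a. choose_a c V \<tau> a \<longrightarrow> a \<in> AA V \<and> Neff a c \<ge> \<tau> * real (card V))"
  using always_returns_le_one[OF assms(1)] choose_a_sound[OF assms(1)] assms(2,4) by blast

end
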